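(* Let $n\geq 1$ and $1\leq k\leq n$ be integers, and let $\lambda$ be a partition of $n=\sum_{j=1}^k\lambda_j$ having exactly $k$ nonzero parts $\lambda_1\geq\lambda_2\geq\dots\geq\lambda_k\geq 1$. Let $\mathcal{HT}_\lambda(n+1)$ be the set of hypertrees with vertex set $\{0,\dots,n\}$ and with exactly $k$ hyperedges, of sizes $1+\lambda_1,1+\lambda_2,\dots,1+\lambda_k$ (as a multiset). Then, with $x_0,\dots,x_n$ commuting indeterminates, $$\sum_{T\in\mathcal{HT}_\lambda(n+1)}\ \prod_{j=0}^n x_j^{\deg(j)-1}=\binom{n}{\lambda}\frac{1}{\prod_{j=1}^n(\nu_j)!}\left(x_0+x_1+\dots+x_n\right)^{k-1},$$ where $\deg(j)$ is the degree of vertex $j$ in $T$ and $\nu_j=\sharp\{i\mid\lambda_i=j\}$ is the number of parts of length $j$ in $\lambda$.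
   Context: A (finite) hypergraph is a pair $(\mathcal V,\mathcal E)$ consisting of a finite set $\mathcal V$ of vertices and a set $\mathcal E$ of hyperedges, which are subsets of $\mathcal V$ containing at least two elements. The size of a hyperedge $E$ is its number of vertices; the degree $\deg(v)$ of a vertex $v$ is the number of hyperedges containing $v$. Two distinct vertices are adjacent if they are both contained in some hyperedge. A path of length $k$ joining $v$ and $w$ is a sequence $v_0=v,v_1,\dots,v_k=w$ of vertices that are consecutively adjacent. A hypergraph is connected if any two vertices can be joined by a path. A cycle of length $k$ (for $k\geq 3$) is a closed path consisting of $k$ distinct vertices. A hyperforest is a hypergraph such that two distinct hyperedges intersect in at most one common vertex and such that every cycle is contained in a hyperedge. A hypertree is a connected hyperforest. Hypertrees are counted as labelled objects: two hypertrees on $\{0,\dots,n\}$ are the same only if their hyperedge sets are equal. Multinomial coefficient: $\binom{n}{\lambda}=\frac{n!}{\prod_{j=1}^k\lambda_j!}$. *)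

theory Defs
  imports Complex_Main "HOL-Library.Multiset" "HOL-Library.Poly_Mapping"
begin

definition hypergraph :: "'a set \<Rightarrow> 'a set set \<Rightarrow> bool" where
  "hypergraph V E \<longleftrightarrow> finite V \<and> (\<forall>e\<in>E. e \<subseteq> V \<and> 2 \<le> card e)"

definition hdegree :: "'a set set \<Rightarrow> 'a \<Rightarrow> nat" where
  "hdegree E v = card {e \<in> E. v \<in> e}"

definition adjacent :: "'a set set \<Rightarrow> 'a \<Rightarrow> 'a \<Rightarrow> bool" where
  "adjacent E v w \<longleftrightarrow> v \<noteq> w \<and> (\<exists>e\<in>E. v \<in> e \<and> w \<in> e)"

text \<open>A path of length \<open>m\<close> is the list of its \<open>m + 1\<close> vertices.\<close>

definition is_path :: "'a set \<Rightarrow> 'a set set \<Rightarrow> 'a \<Rightarrow> 'a list \<Rightarrow> 'a \<Rightarrow> bool" where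
  "is_path V E v p w \<longleftrightarrow>
     p \<noteq> [] \<and> set p \<subseteq> V \<and> hd p = v \<and> last p = w \<and> successively (adjacent E) p"

definition path_length :: "'a list \<Rightarrow> nat" where
  "path_length p = length p - 1"

definition connected_hypergraph :: "'a set \<Rightarrow> 'a set set \<Rightarrow> bool" where
  "connected_hypergraph V E \<longleftrightarrow>
     hypergraph V E \<and> (\<forall>v\<in>V. \<forall>w\<in>V. \<exists>p. is_path V E v p w)"

text \<open>In a closed path the first vertex is repeated as the last one, so distinctness
  is required of the tail only.\<close>

definition is_cycle :: "'a set \<Rightarrow> 'a set set \<Rightarrow> 'a list \<Rightarrow> bool" where
  "is_cycle V E p \<longleftrightarrow>
     (\<exists>v. is_path V E v p v) \<and> 3 \<le> path_length p \<and> distinct (tl p)"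

definition hyperforest :: "'a set \<Rightarrow> 'a set set \<Rightarrow> bool" where
  "hyperforest V E \<longleftrightarrow> hypergraph V E \<and>
     (\<forall>e\<in>E. \<forall>f\<in>E. e \<noteq> f \<longrightarrow> card (e \<inter> f) \<le> 1) \<and>
     (\<forall>p. is_cycle V E p \<longrightarrow> (\<exists>e\<in>E. set p \<subseteq> e))"

definition hypertree :: "'a set \<Rightarrow> 'a set set \<Rightarrow> bool" where
  "hypertree V E \<longleftrightarrow> hyperforest V E \<and> connected_hypergraph V E"

text \<open>A partition of \<open>n\<close> into \<open>k\<close> parts is the weakly decreasing list of its parts;
  the part \<open>\<lambda>\<^sub>i\<close> is \<open>lam ! (i - 1)\<close>.\<close>

definition partition_into :: "nat \<Rightarrow> nat \<Rightarrow> nat list \<Rightarrow> bool" where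
  "partition_into n k lam \<longleftrightarrow>
     length lam = k \<and> sum_list lam = n \<and> (\<forall>l\<in>set lam. 1 \<le> l) \<and> sorted_wrt (\<ge>) lam"

definition mult_of_part :: "nat list \<Rightarrow> nat \<Rightarrow> nat" where
  "mult_of_part lam j = card {i. i < length lam \<and> lam ! i = j}"

definition multinomial :: "nat \<Rightarrow> nat list \<Rightarrow> rat" where
  "multinomial n lam = fact n / (\<Prod>i<length lam. fact (lam ! i))"

text \<open>A hypertree on the fixed vertex set \<open>{0..n}\<close> is represented by its set of hyperedges.
  The equation of multisets also fixes the number of hyperedges to be \<open>length lam\<close>.\<close>

definition HT :: "nat list \<Rightarrow> nat \<Rightarrow> nat set set set" where
  "HT lam n = {T. hypertree {0..n} T \<and>
     image_mset card (mset_set T) = image_mset (\<lambda>l. 1 + l) (mset lam)}"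

text \<open>Polynomials with rational coefficients in the indeterminates \<open>x\<^sub>0, x\<^sub>1, \<dots>\<close>:
  finitely supported maps from monomials, i.e. finitely supported exponent vectors, to
  coefficients, with the convolution product.\<close>

type_synonym mpoly = "(nat \<Rightarrow>\<^sub>0 nat) \<Rightarrow>\<^sub>0 rat"

definition indet :: "nat \<Rightarrow> mpoly" where
  "indet j = Poly_Mapping.single (Poly_Mapping.single j 1) 1"

definition const_poly :: "rat \<Rightarrow> mpoly" where
  "const_poly c = Poly_Mapping.single 0 c"

end

theory Submission
  imports Defs "HOL-Library.Disjoint_Sets" "HOL-Library.FuncSet"
begin

text \<open>
  Root a hypertree at the vertex \<open>0\<close>. Every hyperedge has a unique vertex nearest to the root, its
  parent; removing the parent from each hyperedge leaves blocks that form a set partition \<open>P\<close> of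
  \<open>{1..n}\<close> whose block sizes are the parts of \<open>\<lambda>\<close>. Conversely, a set partition \<open>P\<close> together with a
  choice \<open>p\<close> of a parent vertex for each block is a hypertree exactly when \<open>p\<close> creates no circular
  dependency among the blocks (\<open>bij_betw_edges_of\<close>). A vertex \<open>j \<noteq> 0\<close> lies in one block, so its degree
  minus one is the number of blocks with parent \<open>j\<close>, while for the root that number is the whole
  degree. Hence \<open>x\<^sub>0\<close> times the weight of a hypertree is the product of \<open>x (p B)\<close> over the blocks \<open>B\<close>
  (\<open>prod_degree_edges_of\<close>).

  The sum therefore factors into two independent counts. The number of set partitions with block
  sizes \<open>\<lambda>\<close> is the multinomial coefficient divided by the factorials of the multiplicities
  (\<open>card_partitions_of_type\<close>). For each of them the sum over all admissible \<open>p\<close> is a weighted Cayley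
  formula, \<open>x\<^sub>0 (x\<^sub>0 + \<dots> + x\<^sub>n) ^ (k - 1)\<close>, whatever the partition (\<open>sum_parent_functions\<close>). The extra
  factor \<open>x\<^sub>0\<close> cancels because polynomials over the rationals form an integral domain.

  The Cayley formula is proved for a whole set \<open>R\<close> of roots by peeling off the first layer, the set
  \<open>S\<close> of blocks with parent in \<open>R\<close>: the other blocks then form a forest of the same kind with root
  set \<open>\<Union>S\<close>. The link between cycles and circular dependencies goes through an inductive
  description of rooted hypertrees (\<open>grown\<close>): each arises from the bare root by attaching pendant
  hyperedges.
\<close>

section \<open>Set partitions with prescribed block sizes\<close>

definition partitions_of_type :: "'a set \<Rightarrow> nat multiset \<Rightarrow> 'a set set set" where
  "partitions_of_type A M = {P. partition_on A P \<and> image_mset card (mset_set P) = M}"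

lemma finite_partitions_of_type: "finite A \<Longrightarrow> finite (partitions_of_type A M)"
  using finitely_many_partition_on[of A]
  by (rule finite_subset[rotated]) (auto simp: partitions_of_type_def)

lemma count_blocks_of_size:
  assumes "finite P"
  shows "count (image_mset card (mset_set P)) l = card {B \<in> P. card B = l}"
  using assms by (auto simp: count_image_mset' intro!: arg_cong[where f = card])

lemma bij_betw_partitions_containing_block:
  assumes "finite A" "B \<subseteq> A" "B \<noteq> {}"
  shows "bij_betw (insert B) (partitions_of_type (A - B) M)
    {P \<in> partitions_of_type A (add_mset (card B) M). B \<in> P}"
proof (rule bij_betw_byWitness[where f' = "\<lambda>P. P - {B}"])
  have notin: "B \<notin> P" if "P \<in> partitions_of_type (A - B) M" for P
    using that assms by (auto simp: partitions_of_type_def partition_on_def)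
  show "\<forall>P\<in>partitions_of_type (A - B) M. insert B P - {B} = P"
    using notin by auto
  show "\<forall>P\<in>{P \<in> partitions_of_type A (add_mset (card B) M). B \<in> P}. insert B (P - {B}) = P"
    by auto
  show "insert B ` partitions_of_type (A - B) M
    \<subseteq> {P \<in> partitions_of_type A (add_mset (card B) M). B \<in> P}"
  proof clarsimp
    fix P assume P: "P \<in> partitions_of_type (A - B) M"
    then have part: "partition_on (A - B) P" by (simp add: partitions_of_type_def)
    then have "finite P" "disjnt B (\<Union>P)"
      using assms finite_elements[of "A - B" P] by (auto simp: partition_on_def disjnt_def)
    then show "insert B P \<in> partitions_of_type A (add_mset (card B) M)"
      using P notin[OF P] part assms by (auto simp: partitions_of_type_def partition_on_insert)
  qed
  show "(\<lambda>P. P - {B}) ` {P \<in> partitions_of_type A (add_mset (card B) M). B \<in> P}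
    \<subseteq> partitions_of_type (A - B) M"
  proof clarsimp
    fix P assume P: "P \<in> partitions_of_type A (add_mset (card B) M)" "B \<in> P"
    define Q where "Q = P - {B}"
    have Q: "P = insert B Q" "B \<notin> Q" using P by (auto simp: Q_def)
    have part: "partition_on A (insert B Q)" using P Q by (simp add: partitions_of_type_def)
    then have "finite Q" "disjnt B (\<Union>Q)"
      using finite_elements[OF assms(1) part] Q(2)
      by (auto simp: partition_on_def disjnt_def disjoint_def)
    then show "P - {B} \<in> partitions_of_type (A - B) M"
      using P Q part unfolding Q_def[symmetric]
      by (auto simp: partitions_of_type_def partition_on_insert)
  qed
qed

text \<open>
  Both sides count pairs of a set partition and one of its blocks of size \<open>l\<close>: every partition
  has \<open>Suc (count M l)\<close> such blocks, and a chosen block is completed by partitioning its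
  complement.
\<close>
lemma card_partitions_of_type_add_mset:
  assumes "finite A" "l > 0"
  shows "card (partitions_of_type A (add_mset l M)) * Suc (count M l) =
    (\<Sum>B | B \<subseteq> A \<and> card B = l. card (partitions_of_type (A - B) M))"
proof -
  let ?N = "partitions_of_type A (add_mset l M)" and ?S = "{B. B \<subseteq> A \<and> card B = l}"
  have fin: "finite ?N" "finite ?S"
    using assms by (auto simp: finite_partitions_of_type)
  have "card ?N * Suc (count M l) = (\<Sum>P\<in>?N. card {B \<in> ?S. B \<in> P})"
  proof -
    have "card {B \<in> ?S. B \<in> P} = Suc (count M l)" if "P \<in> ?N" for P
    proof -
      have P: "partition_on A P" "image_mset card (mset_set P) = add_mset l M"
        using that by (auto simp: partitions_of_type_def)
      have "{B \<in> ?S. B \<in> P} = {B \<in> P. card B = l}"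
        using P(1) by (auto simp: partition_on_def)
      then show ?thesis
        using count_blocks_of_size[of P l] finite_elements[OF assms(1) P(1)] P(2) by simp
    qed
    then show ?thesis by simp
  qed
  also have "\<dots> = (\<Sum>B\<in>?S. card {P \<in> ?N. B \<in> P})"
    using sum.swap_restrict[OF fin, of "\<lambda>_ _. 1::nat" "\<lambda>P B. B \<in> P"] by simp
  also have "\<dots> = (\<Sum>B\<in>?S. card (partitions_of_type (A - B) M))"
  proof (rule sum.cong[OF refl])
    fix B assume "B \<in> ?S"
    then have "bij_betw (insert B) (partitions_of_type (A - B) M) {P \<in> ?N. B \<in> P}"
      using bij_betw_partitions_containing_block[of A B M] assms by force
    then show "card {P \<in> ?N. B \<in> P} = card (partitions_of_type (A - B) M)"
      by (simp add: bij_betw_same_card)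
  qed
  finally show ?thesis .
qed

text \<open>
  Induction on the type: adding a part \<open>l\<close> multiplies the number of partitions by
  \<open>(card A choose l) / (count M l + 1)\<close>. The index set \<open>J\<close> may be larger than the set of parts,
  which keeps it fixed during the induction.
\<close>
lemma card_partitions_of_type:
  assumes "finite A" "sum_mset M = card A" "0 \<notin># M" "finite J" "set_mset M \<subseteq> J"
  shows "card (partitions_of_type A M) * (\<Prod>l\<in>#M. fact l) * (\<Prod>j\<in>J. fact (count M j)) =
    (fact (card A) :: nat)"
  using assms
proof (induction M arbitrary: A)
  case empty
  then have "A = {}" by simp
  then have "partitions_of_type A {#} = {{}}"
    by (auto simp: partitions_of_type_def partition_on_empty)
  with \<open>A = {}\<close> show ?case by simp
next
  case (add l M)
  define c :: nat where "c = (\<Prod>l\<in>#M. fact l) * (\<Prod>j\<in>J. fact (count M j))"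
  have l: "l > 0" "l \<in> J" using add.prems by auto
  have cardA: "card A = l + sum_mset M" using add.prems by simp
  have "(\<Prod>j\<in>J. fact (count (add_mset l M) j)) =
      (\<Prod>j\<in>J. fact (count M j) * (if j = l then Suc (count M l) else 1) :: nat)"
    by (intro prod.cong) auto
  also have "\<dots> = (\<Prod>j\<in>J. fact (count M j)) * Suc (count M l)"
    using add.prems l by (simp add: prod.distrib prod.delta)
  finally have "card (partitions_of_type A (add_mset l M)) * (\<Prod>l\<in>#add_mset l M. fact l) *
      (\<Prod>j\<in>J. fact (count (add_mset l M) j)) =
      (card (partitions_of_type A (add_mset l M)) * Suc (count M l)) * fact l * c"
    by (simp add: c_def algebra_simps)
  also have "card (partitions_of_type A (add_mset l M)) * Suc (count M l) =
      (\<Sum>B | B \<subseteq> A \<and> card B = l. card (partitions_of_type (A - B) M))"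
    by (rule card_partitions_of_type_add_mset[OF add.prems(1) l(1)])
  also have "\<dots> * fact l * c = (card A choose l) * fact l * fact (card A - l)"
  proof -
    have "(\<Sum>B | B \<subseteq> A \<and> card B = l. card (partitions_of_type (A - B) M)) * c =
        (\<Sum>B | B \<subseteq> A \<and> card B = l. fact (sum_mset M))"
      unfolding sum_distrib_right
    proof (rule sum.cong[OF refl])
      fix B assume "B \<in> {B. B \<subseteq> A \<and> card B = l}"
      then have *: "card (A - B) = sum_mset M"
        using cardA add.prems(1) by (auto simp: card_Diff_subset finite_subset)
      have "card (partitions_of_type (A - B) M) * c = fact (card (A - B))"
        unfolding c_def mult.assoc[symmetric]
        by (rule add.IH) (use * add.prems in auto)
      with * show "card (partitions_of_type (A - B) M) * c = fact (sum_mset M)"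
        by simp
    qed
    also have "\<dots> = (card A choose l) * fact (card A - l)"
      using add.prems(1) cardA by (simp add: n_subsets)
    finally show ?thesis by (metis (no_types) mult.assoc mult.commute)
  qed
  also have "\<dots> = fact (card A)"
    using binomial_fact_lemma[of l "card A"] cardA by (simp add: ac_simps)
  finally show ?case .
qed

section \<open>Acyclic parent functions and a weighted Cayley formula\<close>

text \<open>
  The condition is well-foundedness of "the parent of \<open>B\<close> lies in the block \<open>C\<close>": in every nonempty
  set \<open>X\<close> of blocks some block hangs from a root or from a block outside \<open>X\<close>. Singletons
  \<open>X\<close> show that \<open>p\<close> maps into \<open>R \<union> \<Union>P\<close>. In contrast to reachability from the roots, this form passes
  directly to subsets of \<open>P\<close>.
\<close>
definition parent_functions :: "'a set \<Rightarrow> 'a set set \<Rightarrow> ('a set \<Rightarrow> 'a) set" where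
  "parent_functions R P = {p \<in> extensional P.
     \<forall>X\<subseteq>P. X \<noteq> {} \<longrightarrow> (\<exists>B\<in>X. p B \<in> R \<union> \<Union>(P - X))}"

lemma parent_functionsD:
  assumes "p \<in> parent_functions R P" "X \<subseteq> P" "X \<noteq> {}"
  obtains B where "B \<in> X" "p B \<in> R \<union> \<Union>(P - X)"
  using assms unfolding parent_functions_def by blast

lemma parent_functions_range:
  assumes "p \<in> parent_functions R P" "B \<in> P"
  shows "p B \<in> R \<union> \<Union>(P - {B})"
  using parent_functionsD[OF assms(1), of "{B}"] assms(2) by blast

lemma finite_parent_functions:
  assumes "finite P" "finite R" "\<And>B. B \<in> P \<Longrightarrow> finite B"
  shows "finite (parent_functions R P)"
proof (rule finite_subset)
  show "parent_functions R P \<subseteq> P \<rightarrow>\<^sub>E (R \<union> \<Union>P)"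
  proof
    fix p assume p: "p \<in> parent_functions R P"
    then have "p \<in> extensional P" by (simp add: parent_functions_def)
    moreover have "p B \<in> R \<union> \<Union>P" if "B \<in> P" for B
      using parent_functions_range[OF p that] by blast
    ultimately show "p \<in> P \<rightarrow>\<^sub>E (R \<union> \<Union>P)" by (auto simp: PiE_def)
  qed
  show "finite (P \<rightarrow>\<^sub>E (R \<union> \<Union>P))"
    using assms by (intro finite_PiE) auto
qed

text \<open>
  Splitting a parent function by the set \<open>S\<close> of blocks that hang directly from \<open>R\<close>: on \<open>S\<close> it is an
  arbitrary function to \<open>R\<close>, and the rest is a parent function whose root set is \<open>\<Union>S\<close>.
\<close>
lemma sum_parent_functions_layers:
  fixes x :: "'a \<Rightarrow> 'r :: comm_semiring_1"
  assumes "finite P" "finite R" "\<And>B. B \<in> P \<Longrightarrow> finite B" "R \<inter> \<Union>P = {}"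
  shows "(\<Sum>p\<in>parent_functions R P. \<Prod>B\<in>P. x (p B)) =
    (\<Sum>S\<in>Pow P. sum x R ^ card S * (\<Sum>p\<in>parent_functions (\<Union>S) (P - S). \<Prod>B\<in>P - S. x (p B)))"
proof -
  let ?I = "SIGMA S:Pow P. (S \<rightarrow>\<^sub>E R) \<times> parent_functions (\<Union>S) (P - S)"
  let ?merge = "\<lambda>(S, f, g) B. if B \<in> S then f B else g B"
  let ?split = "\<lambda>p. ({B \<in> P. p B \<in> R}, restrict p {B \<in> P. p B \<in> R}, restrict p (P - {B \<in> P. p B \<in> R}))"
  have fin: "finite S" "finite (S \<rightarrow>\<^sub>E R)" "finite (\<Union>S)" if "S \<in> Pow P" for S
    using that assms finite_subset[of S P] by (auto intro!: finite_PiE)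
  have fing: "finite (parent_functions (\<Union>S) (P - S))" if "S \<in> Pow P" for S
    using fin[OF that] assms by (intro finite_parent_functions) auto
  have low: "g B \<notin> R" if "S \<subseteq> P" "g \<in> parent_functions (\<Union>S) (P - S)" "B \<in> P - S" for S g B
    using parent_functions_range[OF that(2,3)] assms(4) that(1) by blast
  have merge: "?merge (S, f, g) \<in> parent_functions R P"
    if S: "S \<subseteq> P" and f: "f \<in> S \<rightarrow>\<^sub>E R" and g: "g \<in> parent_functions (\<Union>S) (P - S)" for S f g
    unfolding parent_functions_def
  proof (intro CollectI conjI allI impI)
    show "?merge (S, f, g) \<in> extensional P"
      using S g by (auto simp: extensional_def parent_functions_def)
    fix X assume X: "X \<subseteq> P" "X \<noteq> {}"
    show "\<exists>B\<in>X. ?merge (S, f, g) B \<in> R \<union> \<Union>(P - X)"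
    proof (cases "X \<inter> S = {}")
      case True
      then obtain B where B: "B \<in> X" "g B \<in> \<Union>S \<union> \<Union>(P - S - X)"
        using parent_functionsD[OF g, of X] X by blast
      moreover have "\<Union>S \<subseteq> \<Union>(P - X)" using S True by auto
      ultimately show ?thesis using True by (intro bexI[of _ B]) auto
    next
      case False
      then obtain B where "B \<in> X" "B \<in> S" by blast
      then show ?thesis using f by (intro bexI[of _ B]) auto
    qed
  qed
  have split: "?split p \<in> ?I" if p: "p \<in> parent_functions R P" for p
  proof -
    define S where "S = {B \<in> P. p B \<in> R}"
    have "restrict p (P - S) \<in> parent_functions (\<Union>S) (P - S)"
      unfolding parent_functions_def
    proof (intro CollectI conjI allI impI)
      fix X assume X: "X \<subseteq> P - S" "X \<noteq> {}"
      then obtain B where B: "B \<in> X" "p B \<in> R \<union> \<Union>(P - X)"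
        using parent_functionsD[OF p, of X] by blast
      moreover have "p B \<notin> R" using B X by (auto simp: S_def)
      moreover have "\<Union>(P - X) = \<Union>S \<union> \<Union>(P - S - X)" using X by (auto simp: S_def)
      ultimately show "\<exists>B\<in>X. restrict p (P - S) B \<in> \<Union>S \<union> \<Union>(P - S - X)"
        using X by (intro bexI[of _ B]) auto
    qed simp
    then show ?thesis unfolding S_def[symmetric] by (auto simp: S_def)
  qed
  have "(\<Sum>p\<in>parent_functions R P. \<Prod>B\<in>P. x (p B)) =
      (\<Sum>(S, f, g)\<in>?I. (\<Prod>B\<in>S. x (f B)) * (\<Prod>B\<in>P - S. x (g B)))"
  proof (rule sum.reindex_bij_witness[where i = ?merge and j = ?split])
    fix p assume p: "p \<in> parent_functions R P"
    show "?merge (?split p) = p"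
      using p by (auto simp: fun_eq_iff parent_functions_def extensional_def)
    show "?split p \<in> ?I" by (rule split[OF p])
    show "(case ?split p of (S, f, g) \<Rightarrow> (\<Prod>B\<in>S. x (f B)) * (\<Prod>B\<in>P - S. x (g B))) = (\<Prod>B\<in>P. x (p B))"
      using assms(1)
      by (auto simp: prod.subset_diff[of "{B \<in> P. p B \<in> R}" P] mult.commute
          intro!: arg_cong2[where f = "(*)"] prod.cong)
  next
    fix t assume "t \<in> ?I"
    then obtain S f g where t: "t = (S, f, g)" and S: "S \<subseteq> P" and f: "f \<in> S \<rightarrow>\<^sub>E R"
      and g: "g \<in> parent_functions (\<Union>S) (P - S)" by auto
    have eq: "{B \<in> P. ?merge (S, f, g) B \<in> R} = S"
      using S f low[OF S g] by auto
    have "restrict (?merge (S, f, g)) S = f"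
      using f by (auto simp: fun_eq_iff PiE_def extensional_def)
    moreover have "restrict (?merge (S, f, g)) (P - S) = g"
      using g by (auto simp: fun_eq_iff parent_functions_def extensional_def)
    ultimately show "?split (?merge t) = t" unfolding t eq by simp
    show "?merge t \<in> parent_functions R P" unfolding t by (rule merge[OF S f g])
  qed
  also have "\<dots> = (\<Sum>S\<in>Pow P. \<Sum>(f, g)\<in>(S \<rightarrow>\<^sub>E R) \<times> parent_functions (\<Union>S) (P - S).
      (\<Prod>B\<in>S. x (f B)) * (\<Prod>B\<in>P - S. x (g B)))"
    using assms(1) fin(2) fing by (subst sum.Sigma) auto
  also have "\<dots> = (\<Sum>S\<in>Pow P. sum x R ^ card S *
      (\<Sum>p\<in>parent_functions (\<Union>S) (P - S). \<Prod>B\<in>P - S. x (p B)))"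
  proof (rule sum.cong[OF refl])
    fix S assume S: "S \<in> Pow P"
    have "(\<Sum>(f, g)\<in>(S \<rightarrow>\<^sub>E R) \<times> parent_functions (\<Union>S) (P - S).
        (\<Prod>B\<in>S. x (f B)) * (\<Prod>B\<in>P - S. x (g B))) =
        (\<Sum>f\<in>S \<rightarrow>\<^sub>E R. \<Prod>B\<in>S. x (f B)) * (\<Sum>p\<in>parent_functions (\<Union>S) (P - S). \<Prod>B\<in>P - S. x (p B))"
      by (simp add: sum.cartesian_product sum_product)
    also have "(\<Sum>f\<in>S \<rightarrow>\<^sub>E R. \<Prod>B\<in>S. x (f B)) = sum x R ^ card S"
      using prod_sum_PiE[of S "\<lambda>_. R" "\<lambda>_. x"] fin[OF S] assms(2) by simp
    finally show "(\<Sum>(f, g)\<in>(S \<rightarrow>\<^sub>E R) \<times> parent_functions (\<Union>S) (P - S).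
        (\<Prod>B\<in>S. x (f B)) * (\<Prod>B\<in>P - S. x (g B))) =
        sum x R ^ card S * (\<Sum>p\<in>parent_functions (\<Union>S) (P - S). \<Prod>B\<in>P - S. x (p B))" .
  qed
  finally show ?thesis .
qed

lemma sum_Pow_card:
  fixes f :: "nat \<Rightarrow> 'r :: comm_semiring_1"
  assumes "finite Q"
  shows "(\<Sum>S\<in>Pow Q. f (card S)) = (\<Sum>i\<le>card Q. of_nat (card Q choose i) * f i)"
proof -
  have "(\<Sum>S\<in>Pow Q. f (card S)) = (\<Sum>i\<le>card Q. \<Sum>S\<in>{S \<in> Pow Q. card S = i}. f (card S))"
    using assms by (intro sum.group[symmetric]) (auto intro: card_mono)
  also have "\<dots> = (\<Sum>i\<le>card Q. of_nat (card Q choose i) * f i)"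
  proof (rule sum.cong[OF refl])
    fix i
    have "(\<Sum>S\<in>{S \<in> Pow Q. card S = i}. f (card S)) = (\<Sum>S\<in>{S. S \<subseteq> Q \<and> card S = i}. f i)"
      by (intro sum.cong) auto
    then show "(\<Sum>S\<in>{S \<in> Pow Q. card S = i}. f (card S)) = of_nat (card Q choose i) * f i"
      using assms by (simp add: n_subsets)
  qed
  finally show ?thesis .
qed

text \<open>
  Every \<open>B\<close> lies in \<open>m choose i\<close> of the subsets of size \<open>i + 1\<close>.
\<close>
lemma sum_Pow_weighted:
  fixes y :: "'b \<Rightarrow> 'r :: comm_semiring_1"
  assumes "finite P" "card P = Suc m"
  shows "(\<Sum>S\<in>Pow P. f (card S) * sum y S) =
    sum y P * (\<Sum>i\<le>m. of_nat (m choose i) * f (Suc i))"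
proof -
  have "(\<Sum>S\<in>Pow P. f (card S) * sum y S) = (\<Sum>S\<in>Pow P. \<Sum>B\<in>{B \<in> P. B \<in> S}. f (card S) * y B)"
    by (intro sum.cong) (auto simp: sum_distrib_left Int_absorb1 Int_def[symmetric] intro!: sum.cong)
  also have "\<dots> = (\<Sum>B\<in>P. \<Sum>S\<in>{S \<in> Pow P. B \<in> S}. f (card S) * y B)"
    using assms(1) by (intro sum.swap_restrict) auto
  also have "\<dots> = (\<Sum>B\<in>P. y B * (\<Sum>i\<le>m. of_nat (m choose i) * f (Suc i)))"
  proof (rule sum.cong[OF refl])
    fix B assume B: "B \<in> P"
    have "(\<Sum>S\<in>{S \<in> Pow P. B \<in> S}. f (card S) * y B) =
        (\<Sum>S\<in>Pow (P - {B}). f (Suc (card S)) * y B)"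
    proof (rule sum.reindex_bij_witness[where i = "insert B" and j = "\<lambda>S. S - {B}"])
      fix S assume "S \<in> {S \<in> Pow P. B \<in> S}"
      then have "finite S" "B \<in> S" using assms(1) finite_subset by auto
      then show "f (Suc (card (S - {B}))) * y B = f (card S) * y B"
        using card_Suc_Diff1[of S B] by simp
    qed (use B in auto)
    also have "\<dots> = (\<Sum>i\<le>m. of_nat (m choose i) * f (Suc i)) * y B"
      using sum_Pow_card[of "P - {B}" "\<lambda>i. f (Suc i)"] assms B
      by (simp add: sum_distrib_right[symmetric])
    finally show "(\<Sum>S\<in>{S \<in> Pow P. B \<in> S}. f (card S) * y B) =
        y B * (\<Sum>i\<le>m. of_nat (m choose i) * f (Suc i))" by (simp add: mult.commute)
  qed
  finally show ?thesis by (simp add: sum_distrib_right)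
qed

text \<open>
  A weighted form of Cayley's formula for rooted forests in which a block \<open>B\<close> is a vertex of weight
  \<open>sum x B\<close>. With \<open>r = sum x R\<close>, \<open>Y = sum x (\<Union>P)\<close> and \<open>card P = m + 1\<close>, the first layer \<open>S\<close>
  contributes, by induction, \<open>r ^ card S * sum x (\<Union>S) * Y ^ (m - card S)\<close> if \<open>S \<noteq> P\<close> and \<open>r ^ (m + 1)\<close>
  if \<open>S = P\<close>; summing over the size of \<open>S\<close> gives \<open>r (r + Y) ^ m\<close> by the binomial theorem.
\<close>
lemma sum_parent_functions:
  fixes x :: "'a \<Rightarrow> 'r :: comm_semiring_1"
  assumes "finite P" "finite R" "\<And>B. B \<in> P \<Longrightarrow> finite B" "R \<inter> \<Union>P = {}" "disjoint P" "P \<noteq> {}"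
  shows "(\<Sum>p\<in>parent_functions R P. \<Prod>B\<in>P. x (p B)) =
    sum x R * (sum x R + sum x (\<Union>P)) ^ (card P - 1)"
  using assms
proof (induction "card P" arbitrary: P R rule: less_induct)
  case less
  obtain m where m: "card P = Suc m"
    using less.prems by (cases "card P") auto
  define r Y where "r = sum x R" and "Y = sum x (\<Union>P)"
  define y where "y = (\<lambda>B. sum x B)"
  have sumU: "sum x (\<Union>S) = sum y S" if "S \<subseteq> P" for S
  proof -
    have "\<forall>A\<in>S. finite A" "\<forall>A\<in>S. \<forall>B\<in>S. A \<noteq> B \<longrightarrow> A \<inter> B = {}"
      using that less.prems(3,5) by (auto simp: disjoint_def subset_iff)
    then show ?thesis by (simp add: sum.Union_disjoint y_def o_def)
  qed
  \<comment> \<open>The exponent \<open>m - s\<close> is one less than the number of blocks outside a layer of size \<open>s\<close>; the full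
    layer \<open>S = P\<close> has none outside and is split off as a separate summand.\<close>
  define f where "f = (\<lambda>s. if s = Suc m then 0 else r ^ s * Y ^ (m - s))"
  have inner: "r ^ card S * (\<Sum>p\<in>parent_functions (\<Union>S) (P - S). \<Prod>B\<in>P - S. x (p B)) =
      f (card S) * sum y S + (if S = P then r ^ Suc m else 0)" if S: "S \<in> Pow P" for S
  proof (cases "S = {}")
    case True
    have "parent_functions {} P = {}"
    proof (rule equals0I)
      fix p assume "p \<in> parent_functions {} P"
      then obtain B where "p B \<in> {} \<union> \<Union>(P - P)"
        using parent_functionsD[of p "{}" P P] less.prems(6) by blast
      then show False by simp
    qed
    then show ?thesis using True less.prems(6) by auto
  next
    case nonempty: False
    have finS: "finite S" using S less.prems(1) finite_subset by auto
    show ?thesis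
    proof (cases "S = P")
      case True
      have "parent_functions (\<Union>P) {} = {\<lambda>_. undefined}"
        by (auto simp: parent_functions_def)
      then show ?thesis using True m by (simp add: f_def)
    next
      case False
      then have psub: "S \<subset> P" using S by auto
      have cS: "card S < Suc m" using psubset_card_mono[OF less.prems(1) psub] m by simp
      have cD: "card (P - S) = Suc m - card S" using S finS m by (simp add: card_Diff_subset)
      have "(\<Sum>p\<in>parent_functions (\<Union>S) (P - S). \<Prod>B\<in>P - S. x (p B)) =
          sum x (\<Union>S) * (sum x (\<Union>S) + sum x (\<Union>(P - S))) ^ (card (P - S) - 1)"
      proof (rule less.hyps)
        show "card (P - S) < card P"
          using cD m nonempty finS card_gt_0_iff[of S] by simp
        show "\<Union>S \<inter> \<Union>(P - S) = {}" using less.prems(5) S by (fastforce simp: disjoint_def)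
        show "finite (\<Union>S)" using finS S less.prems(3) by auto
        show "disjoint (P - S)" using less.prems(5) by (auto simp: disjoint_def)
      qed (use S psub less.prems finS in auto)
      also have "sum x (\<Union>S) + sum x (\<Union>(P - S)) = Y"
        unfolding Y_def using sumU[of S] sumU[of "P - S"] sumU[of P] S less.prems(1)
        by (simp add: sum.subset_diff[of S P] add.commute)
      also have "card (P - S) - 1 = m - card S" using cD by simp
      finally show ?thesis using False cS sumU[of S] S by (simp add: f_def ac_simps)
    qed
  qed
  have "(\<Sum>p\<in>parent_functions R P. \<Prod>B\<in>P. x (p B)) =
      (\<Sum>S\<in>Pow P. r ^ card S * (\<Sum>p\<in>parent_functions (\<Union>S) (P - S). \<Prod>B\<in>P - S. x (p B)))"
    unfolding r_def by (rule sum_parent_functions_layers[OF less.prems(1-4)])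
  also have "\<dots> = (\<Sum>S\<in>Pow P. f (card S) * sum y S + (if S = P then r ^ Suc m else 0))"
    by (rule sum.cong[OF refl inner])
  also have "\<dots> = Y * (\<Sum>i\<le>m. of_nat (m choose i) * f (Suc i)) + r ^ Suc m"
    using sumU[of P] less.prems(1)
    by (simp add: sum.distrib sum_Pow_weighted[OF less.prems(1) m] Y_def)
  also have "Y * (\<Sum>i\<le>m. of_nat (m choose i) * f (Suc i)) =
      (\<Sum>i<m. r * (of_nat (m choose i) * r ^ i * Y ^ (m - i)))"
  proof -
    have "Y * (\<Sum>i\<le>m. of_nat (m choose i) * f (Suc i)) =
        (\<Sum>i<m. Y * (of_nat (m choose i) * f (Suc i)))"
      by (simp add: lessThan_Suc_atMost[symmetric] f_def sum_distrib_left)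
    also have "\<dots> = (\<Sum>i<m. r * (of_nat (m choose i) * r ^ i * Y ^ (m - i)))"
    proof (rule sum.cong[OF refl])
      fix i assume "i \<in> {..<m}"
      then have "Y ^ (m - i) = Y * Y ^ (m - Suc i)"
        by (metis Suc_diff_Suc lessThan_iff power_Suc)
      then show "Y * (of_nat (m choose i) * f (Suc i)) = r * (of_nat (m choose i) * r ^ i * Y ^ (m - i))"
        using \<open>i \<in> {..<m}\<close> by (simp add: f_def ac_simps)
    qed
    finally show ?thesis .
  qed
  also have "\<dots> + r ^ Suc m = r * (r + Y) ^ m"
    by (simp add: binomial_ring lessThan_Suc_atMost[symmetric] sum_distrib_left distrib_left)
  finally show ?case by (simp add: m r_def Y_def)
qed

section \<open>Paths and cycles in hyperforests\<close>

lemma is_path_refl: "v \<in> V \<Longrightarrow> is_path V E v [v] v"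
  by (simp add: is_path_def)

lemma is_path_sym: "is_path V E v p w \<Longrightarrow> is_path V E w (rev p) v"
  by (auto simp: is_path_def hd_rev last_rev adjacent_def elim!: successively_mono)

lemma is_path_trans:
  assumes "is_path V E u p v" "is_path V E v q w"
  shows "is_path V E u (p @ tl q) w"
proof (cases q)
  case (Cons a q')
  with assms show ?thesis
    by (cases q') (auto simp: is_path_def successively_append_iff)
qed (use assms in \<open>simp add: is_path_def\<close>)

lemma is_path_mono: "is_path V E v p w \<Longrightarrow> V \<subseteq> V' \<Longrightarrow> E \<subseteq> E' \<Longrightarrow> is_path V' E' v p w"
  by (auto simp: is_path_def adjacent_def elim!: successively_mono)

lemma connected_hypergraphI_hub:
  assumes "hypergraph V E" "v \<in> V" "\<And>u. u \<in> V \<Longrightarrow> \<exists>p. is_path V E u p v"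
  shows "connected_hypergraph V E"
  unfolding connected_hypergraph_def using assms is_path_trans is_path_sym by metis

lemma simple_path:
  assumes "is_path V E v p w"
  shows "\<exists>q. is_path V E v q w \<and> distinct q"
  using assms
proof (induction p rule: length_induct)
  case (1 p)
  show ?case
  proof (cases "distinct p")
    case False
    then obtain xs ys zs y where p: "p = xs @ [y] @ ys @ [y] @ zs"
      using not_distinct_decomp by blast
    have "successively (adjacent E) (xs @ [y] @ zs)"
      using 1(2) unfolding p is_path_def
      by (auto simp: successively_append_iff successively_append_iff[of _ "y # ys" "y # zs", simplified])
    moreover have "hd (xs @ [y] @ zs) = v" "last (xs @ [y] @ zs) = w" "set (xs @ [y] @ zs) \<subseteq> V"
      using 1(2) unfolding p is_path_def by (cases xs; auto)+
    ultimately have "is_path V E v (xs @ [y] @ zs) w" by (simp add: is_path_def)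
    moreover have "length (xs @ [y] @ zs) < length p" by (simp add: p)
    ultimately show ?thesis using 1(1) by blast
  qed (use 1 in blast)
qed

text \<open>
  A path that ends outside \<open>W\<close> must cross the boundary of \<open>W\<close>.
\<close>
lemma path_leaves_set:
  assumes "is_path V E v p w" "v \<in> W" "w \<notin> W"
  obtains a b where "a \<in> W" "b \<in> V - W" "adjacent E a b"
proof -
  have "\<exists>a\<in>W. \<exists>b\<in>V - W. adjacent E a b"
    using assms
  proof (induction p arbitrary: v)
    case (Cons c p)
    show ?case
    proof (cases p)
      case (Cons d p')
      then have d: "adjacent E v d" "is_path V E d p w" "d \<in> V"
        using Cons.prems by (auto simp: is_path_def)
      then show ?thesis using Cons.IH[of d] Cons.prems by blast
    qed (use Cons.prems in \<open>auto simp: is_path_def\<close>)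
  qed (simp add: is_path_def)
  then show thesis using that by blast
qed

text \<open>
  A cycle written without the repetition of its first vertex, so that it can be rotated.
\<close>
definition cyclic_list :: "'a set \<Rightarrow> 'a set set \<Rightarrow> 'a list \<Rightarrow> bool" where
  "cyclic_list V E q \<longleftrightarrow> 3 \<le> length q \<and> set q \<subseteq> V \<and> distinct q \<and>
     successively (adjacent E) q \<and> adjacent E (last q) (hd q)"

lemma is_cycle_tl: "is_cycle V E p \<Longrightarrow> cyclic_list V E (tl p) \<and> set (tl p) = set p"
  by (cases p)
    (auto simp: is_cycle_def is_path_def path_length_def cyclic_list_def successively_Cons split: if_splits)

lemma cyclic_list_is_cycle: "cyclic_list V E q \<Longrightarrow> is_cycle V E (last q # q)"
  by (cases q)
    (auto simp: is_cycle_def is_path_def path_length_def cyclic_list_def successively_Cons)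

lemma cyclic_list_rotate: "cyclic_list V E (xs @ v # ys) \<Longrightarrow> cyclic_list V E (v # ys @ xs)"
  by (cases xs; cases ys)
    (auto simp: cyclic_list_def successively_append_iff successively_Cons split: if_splits)

lemma hyperforest_cyclic_list:
  assumes "hyperforest V E" "cyclic_list V E q"
  obtains e where "e \<in> E" "set q \<subseteq> e"
proof -
  have "\<exists>e\<in>E. set (last q # q) \<subseteq> e"
    using assms(1) cyclic_list_is_cycle[OF assms(2)] unfolding hyperforest_def by blast
  then show thesis using that by auto
qed

lemma common_edge_unique:
  assumes "hyperforest V E" "e \<in> E" "f \<in> E" "a \<in> e \<inter> f" "b \<in> e \<inter> f" "a \<noteq> b"
  shows "e = f"
proof (rule ccontr)
  assume "e \<noteq> f"
  then have le: "card (e \<inter> f) \<le> 1" using assms by (auto simp: hyperforest_def)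
  have "finite e"
    using assms(1,2) finite_subset by (auto simp: hyperforest_def hypergraph_def)
  then have "card {a, b} \<le> card (e \<inter> f)" by (intro card_mono) (use assms in auto)
  with le assms(6) show False by simp
qed

text \<open>
  Join two vertices \<open>a\<close>, \<open>b\<close> of \<open>e\<close> by a simple path in \<open>U\<close> and close it up through \<open>e\<close>. The
  resulting cycle lies in a single hyperedge, which has to be \<open>e\<close> since it contains \<open>a\<close> and \<open>b\<close>. But
  the first step of the path uses a hyperedge of \<open>U\<close> that also shares two vertices with \<open>e\<close>, so that
  hyperedge is \<open>e\<close>.
\<close>
lemma edge_within_connected_part:
  assumes T: "hyperforest V T" and U: "U \<subseteq> T" "connected_hypergraph W U" "W \<subseteq> V"
    and e: "e \<in> T" "a \<in> e" "b \<in> e" "a \<in> W" "b \<in> W" "a \<noteq> b"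
  shows "e \<in> U"
proof -
  obtain p where p: "is_path W U a p b" "distinct p"
    using U(2) e simple_path[of W U a _ b] unfolding connected_hypergraph_def by blast
  then obtain c p' where cp: "p = a # c # p'"
    using e(6) by (cases p; cases "tl p") (auto simp: is_path_def)
  then have "adjacent U a c" using p by (simp add: is_path_def)
  then obtain g where g: "g \<in> U" "a \<in> g" "c \<in> g" "a \<noteq> c" by (auto simp: adjacent_def)
  have "e = g"
  proof (cases "p' = []")
    case True
    then have "c = b" using p cp by (simp add: is_path_def)
    then show ?thesis using common_edge_unique[OF T, of e g a b] e g U(1) by auto
  next
    case False
    have "successively (adjacent T) p"
      using p(1) U(1) by (auto simp: is_path_def adjacent_def elim!: successively_mono)
    moreover have "adjacent T b a" using e by (auto simp: adjacent_def)
    moreover have "3 \<le> length p" using cp False by (cases p') auto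
    ultimately have "cyclic_list V T p"
      using p U(3) unfolding cyclic_list_def is_path_def by auto
    then obtain f where f: "f \<in> T" "set p \<subseteq> f" by (rule hyperforest_cyclic_list[OF T])
    have "b \<in> set p" using p(1) by (auto simp: is_path_def)
    then have "e = f" using common_edge_unique[OF T, of e f a b] f e cp by auto
    moreover have "f = g" using common_edge_unique[OF T, of f g a c] f g cp U(1) by auto
    ultimately show ?thesis by simp
  qed
  with g show ?thesis by simp
qed

section \<open>Hypertrees grown from a root by pendant hyperedges\<close>

inductive grown :: "'a \<Rightarrow> 'a set \<Rightarrow> 'a set set \<Rightarrow> bool" for r where
  root: "grown r {r} {}"
| pendant: "\<lbrakk>grown r W T; v \<in> W; finite B; B \<noteq> {}; B \<inter> W = {}\<rbrakk> \<Longrightarrow>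
    grown r (W \<union> B) (insert (insert v B) T)"

text \<open>
  Only \<open>v\<close> connects the old vertices \<open>W\<close> with the new vertices \<open>B\<close> of a pendant hyperedge, so a
  path that avoids \<open>v\<close> stays on one side.
\<close>
lemma path_avoiding_attachment:
  assumes "B \<inter> W = {}" "\<Union>T \<subseteq> W"
    and "successively (adjacent (insert (insert v B) T)) q" "v \<notin> set q" "set q \<subseteq> W \<union> B"
  shows "set q \<subseteq> W \<or> set q \<subseteq> B"
  using assms(3-)
proof (induction q)
  case (Cons a q)
  show ?case
  proof (cases q)
    case (Cons b q')
    with Cons.prems have "adjacent (insert (insert v B) T) a b" by simp
    then have "a \<in> W \<longleftrightarrow> b \<in> W"
      using Cons.prems Cons assms(1,2) by (auto simp: adjacent_def)
    moreover have "set q \<subseteq> W \<or> set q \<subseteq> B" using Cons.IH Cons.prems Cons by simp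
    ultimately show ?thesis using Cons.prems Cons assms(1) by auto
  qed (use Cons.prems in auto)
qed simp

text \<open>
  A cycle passes through the cut vertex \<open>v\<close> at most once. Rotated so that it starts at \<open>v\<close>, its
  remainder avoids \<open>v\<close> and hence stays on one side.
\<close>
lemma cycle_within_part_or_pendant_edge:
  assumes "B \<inter> W = {}" "v \<in> W" "\<Union>T \<subseteq> W"
    and q: "cyclic_list (W \<union> B) (insert (insert v B) T) q"
  shows "cyclic_list W T q \<or> set q \<subseteq> insert v B"
proof -
  have "set q \<subseteq> W \<or> set q \<subseteq> insert v B"
  proof (cases "v \<in> set q")
    case False
    then show ?thesis
      using path_avoiding_attachment[OF assms(1,3)] q unfolding cyclic_list_def by blast
  next
    case True
    then obtain xs ys where q_eq: "q = xs @ v # ys" by (meson split_list)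
    have "cyclic_list (W \<union> B) (insert (insert v B) T) (v # ys @ xs)"
      using q unfolding q_eq by (rule cyclic_list_rotate)
    then have "set (ys @ xs) \<subseteq> W \<or> set (ys @ xs) \<subseteq> B"
      by (intro path_avoiding_attachment[OF assms(1,3)])
        (auto simp: cyclic_list_def successively_Cons)
    then show ?thesis using assms(2) q_eq by auto
  qed
  moreover have "cyclic_list W T q" if sub: "set q \<subseteq> W"
  proof -
    have adj: "adjacent T a b" if "a \<in> set q" "b \<in> set q" "adjacent (insert (insert v B) T) a b" for a b
      using that sub assms(1) by (auto simp: adjacent_def)
    have "q \<noteq> []" using q by (auto simp: cyclic_list_def)
    then show ?thesis
      using q sub adj unfolding cyclic_list_def by (auto elim!: successively_mono)
  qed
  ultimately show ?thesis by blast
qed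

lemma hypertree_pendant:
  assumes T: "hypertree W T" and v: "v \<in> W" and B: "finite B" "B \<noteq> {}" "B \<inter> W = {}"
  shows "hypertree (W \<union> B) (insert (insert v B) T)"
proof -
  let ?e = "insert v B"
  have hg: "hypergraph W T" and forest: "hyperforest W T" and conn: "connected_hypergraph W T"
    using T by (auto simp: hypertree_def hyperforest_def)
  have sub: "\<Union>T \<subseteq> W" using hg by (auto simp: hypergraph_def)
  have "card ?e \<ge> 2"
    using B v by (auto simp: card_insert_if Suc_le_eq card_gt_0_iff)
  then have hg': "hypergraph (W \<union> B) (insert ?e T)"
    using hg B v by (auto simp: hypergraph_def)
  have "card (?e \<inter> f) \<le> 1" if "f \<in> T" for f
    using card_mono[of "{v}" "?e \<inter> f"] that sub B by auto
  then have meet: "\<forall>e\<in>insert ?e T. \<forall>f\<in>insert ?e T. e \<noteq> f \<longrightarrow> card (e \<inter> f) \<le> 1"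
    using forest by (auto simp: hyperforest_def Int_commute)
  have cyc: "\<exists>e\<in>insert ?e T. set p \<subseteq> e" if "is_cycle (W \<union> B) (insert ?e T) p" for p
  proof -
    have tl: "cyclic_list (W \<union> B) (insert ?e T) (tl p)" "set (tl p) = set p"
      using is_cycle_tl[OF that] by auto
    have "cyclic_list W T (tl p) \<or> set (tl p) \<subseteq> ?e"
      by (rule cycle_within_part_or_pendant_edge[OF B(3) v sub tl(1)])
    then show ?thesis
      using hyperforest_cyclic_list[OF forest, of "tl p"] tl(2) by (metis insertCI)
  qed
  have "connected_hypergraph (W \<union> B) (insert ?e T)"
  proof (rule connected_hypergraphI_hub[OF hg', of v])
    fix u assume "u \<in> W \<union> B"
    then show "\<exists>p. is_path (W \<union> B) (insert ?e T) u p v"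
    proof
      assume "u \<in> W"
      then obtain p where "is_path W T u p v"
        using conn v by (auto simp: connected_hypergraph_def)
      then show ?thesis using is_path_mono[of W T u p v "W \<union> B" "insert ?e T"] by blast
    next
      assume "u \<in> B"
      then have "is_path (W \<union> B) (insert ?e T) u [u, v] v"
        using v B by (auto simp: is_path_def adjacent_def)
      then show ?thesis by blast
    qed
  qed (use v in simp)
  with hg' meet cyc show ?thesis by (auto simp: hypertree_def hyperforest_def)
qed

lemma grown_hypertree: "grown r W T \<Longrightarrow> hypertree W T \<and> r \<in> W"
proof (induction rule: grown.induct)
  case root
  have "hypertree {r} {}"
    by (auto simp: hypertree_def hyperforest_def connected_hypergraph_def hypergraph_def
        intro: is_path_refl dest!: is_cycle_tl)
      (auto simp: cyclic_list_def adjacent_def)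
  then show ?case by simp
next
  case (pendant W T v B)
  then show ?case using hypertree_pendant[of W T v B] by simp
qed

text \<open>
  Take a maximal grown part \<open>U\<close> of \<open>T\<close>. A hyperedge outside \<open>U\<close> meets the vertex set \<open>W\<close> of \<open>U\<close> at
  most once, by \<open>edge_within_connected_part\<close>. If \<open>W \<noteq> V\<close>, connectedness gives a hyperedge that meets
  both \<open>W\<close> and its complement; it could be attached to \<open>U\<close> as a pendant hyperedge, against
  maximality. So \<open>W = V\<close>, and no hyperedge can be outside \<open>U\<close>.
\<close>
lemma hypertree_grown:
  assumes T: "hypertree V T" and r: "r \<in> V"
  shows "grown r V T"
proof -
  have forest: "hyperforest V T" and conn: "connected_hypergraph V T" and "finite V"
    and edges: "\<And>e. e \<in> T \<Longrightarrow> e \<subseteq> V \<and> 2 \<le> card e"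
    using T by (auto simp: hypertree_def hyperforest_def hypergraph_def)
  have "finite T" using edges \<open>finite V\<close> by (meson PowI finite_Pow_iff finite_subset subsetI)
  let ?Q = "{U \<in> Pow T. \<exists>W\<subseteq>V. grown r W U}"
  have "{} \<in> ?Q" using r by (auto intro: grown.root)
  then have "?Q \<noteq> {}" by blast
  moreover have "finite ?Q" using \<open>finite T\<close> by simp
  ultimately have "\<exists>U\<in>?Q. \<forall>U'\<in>?Q. U \<subseteq> U' \<longrightarrow> U = U'"
    by (intro finite_has_maximal)
  then obtain U where U: "U \<in> ?Q" and max: "\<And>U'. U' \<in> ?Q \<Longrightarrow> U \<subseteq> U' \<Longrightarrow> U = U'"
    by (elim bexE) (rule that, assumption, drule bspec, assumption, erule mp)
  then obtain W where W: "W \<subseteq> V" "grown r W U" by auto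
  have part: "connected_hypergraph W U" "r \<in> W" "\<Union>U \<subseteq> W"
    using grown_hypertree[OF W(2)]
    by (auto simp: hypertree_def hyperforest_def hypergraph_def connected_hypergraph_def)
  have once: "a = b" if "e \<in> T - U" "a \<in> e \<inter> W" "b \<in> e \<inter> W" for e a b
    using edge_within_connected_part[OF forest _ part(1) W(1)] U that by blast
  have "W = V"
  proof (rule ccontr)
    assume "W \<noteq> V"
    then obtain w where w: "w \<in> V" "w \<notin> W" using W by auto
    then obtain p where "is_path V T r p w" using conn r by (auto simp: connected_hypergraph_def)
    then obtain a b where ab: "a \<in> W" "b \<in> V - W" "adjacent T a b"
      using path_leaves_set part(2) w(2) by metis
    then obtain e where e: "e \<in> T" "a \<in> e" "b \<in> e" by (auto simp: adjacent_def)
    then have "e \<notin> U" using ab part(3) by auto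
    have "grown r (W \<union> (e - {a})) (insert (insert a (e - {a})) U)"
    proof (rule grown.pendant[OF W(2) ab(1)])
      have "c = a" if "c \<in> e" "c \<in> W" for c
        by (rule once[of e]) (use e \<open>e \<notin> U\<close> ab that in blast)+
      then show "(e - {a}) \<inter> W = {}" by blast
      show "finite (e - {a})" using edges[OF e(1)] \<open>finite V\<close> finite_subset by auto
    qed (use e ab in auto)
    moreover have "insert a (e - {a}) = e" using e by auto
    ultimately have "grown r (W \<union> (e - {a})) (insert e U)" by simp
    moreover have "W \<union> (e - {a}) \<subseteq> V" using W(1) edges[OF e(1)] by blast
    moreover have "insert e U \<in> Pow T" using U e(1) by blast
    ultimately have "insert e U \<in> ?Q" by blast
    with max[of "insert e U"] \<open>e \<notin> U\<close> show False by auto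
  qed
  have "T \<subseteq> U"
  proof
    fix e assume e: "e \<in> T"
    show "e \<in> U"
    proof (rule ccontr)
      assume "e \<notin> U"
      then have "e \<subseteq> {a}" if "a \<in> e" for a
        using once[of e] e edges[OF e] that unfolding \<open>W = V\<close> by blast
      then have "is_singleton e \<or> e = {}" unfolding is_singleton_def by blast
      then have "card e \<le> 1" by (auto simp: is_singleton_altdef)
      with edges[OF e] show False by simp
    qed
  qed
  then show ?thesis using U W \<open>W = V\<close> by auto
qed

section \<open>Hypertrees as set partitions with parent functions\<close>

definition edges_of :: "('a set \<Rightarrow> 'a) \<Rightarrow> 'a set set \<Rightarrow> 'a set set" where
  "edges_of p P = (\<lambda>B. insert (p B) B) ` P"

text \<open>
  The condition on \<open>p\<close>, applied to the blocks that are not yet attached, always offers a next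
  pendant hyperedge.
\<close>
lemma grown_from_parent_function:
  assumes V: "finite V" "r \<in> V" and P: "partition_on (V - {r}) P" and p: "p \<in> parent_functions {r} P"
  shows "grown r V (edges_of p P)"
proof -
  have "finite P" using P V finite_elements by blast
  have un: "\<Union>P = V - {r}" and dis: "disjoint P" and ne: "{} \<notin> P"
    using P by (auto simp: partition_on_def)
  have "\<exists>Q\<subseteq>P. card Q = i \<and> grown r (insert r (\<Union>Q)) (edges_of p Q)" if "i \<le> card P" for i
    using that
  proof (induction i)
    case 0
    then show ?case by (intro exI[of _ "{}"]) (auto simp: edges_of_def intro: grown.root)
  next
    case (Suc i)
    then obtain Q where Q: "Q \<subseteq> P" "card Q = i" "grown r (insert r (\<Union>Q)) (edges_of p Q)" by auto
    have "P - Q \<noteq> {}" using Q Suc.prems by auto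
    then obtain B where B: "B \<in> P - Q" "p B \<in> {r} \<union> \<Union>(P - (P - Q))"
      using parent_functionsD[OF p, of "P - Q"] by blast
    moreover have "P - (P - Q) = Q" using Q by auto
    ultimately have pB: "p B \<in> insert r (\<Union>Q)" by simp
    have "grown r (insert r (\<Union>Q) \<union> B) (insert (insert (p B) B) (edges_of p Q))"
    proof (rule grown.pendant[OF Q(3) pB])
      show "finite B" using B un V by (auto intro!: finite_subset[of B V])
      show "B \<noteq> {}" using B ne by auto
      have "r \<notin> B" using B(1) un by blast
      moreover have "B \<inter> C = {}" if "C \<in> Q" for C
        using that B(1) Q(1) disjointD[OF dis, of B C] by blast
      ultimately show "B \<inter> insert r (\<Union>Q) = {}" by blast
    qed
    moreover have "insert r (\<Union>Q) \<union> B = insert r (\<Union>(insert B Q))" by auto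
    moreover have "card (insert B Q) = Suc i"
      using B Q \<open>finite P\<close> finite_subset[of Q P] by auto
    ultimately show ?case
      using B Q(1) by (intro exI[of _ "insert B Q"]) (auto simp: edges_of_def)
  qed
  from this[of "card P"] obtain Q where "Q \<subseteq> P" "card Q = card P"
    "grown r (insert r (\<Union>Q)) (edges_of p Q)" by auto
  moreover from this have "Q = P" using \<open>finite P\<close> card_subset_eq by blast
  moreover have "insert r (\<Union>P) = V" using un V by auto
  ultimately show ?thesis by simp
qed

text \<open>
  Each pendant hyperedge adds the block of its new vertices, with the attaching vertex as parent.
\<close>
lemma parent_function_from_grown:
  "grown r V T \<Longrightarrow> \<exists>P p. partition_on (V - {r}) P \<and> p \<in> parent_functions {r} P \<and> T = edges_of p P"
proof (induction rule: grown.induct)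
  case root
  have "partition_on ({r} - {r}) {}" by (simp add: partition_on_empty)
  moreover have "(\<lambda>_. undefined) \<in> parent_functions {r} {}" by (simp add: parent_functions_def)
  ultimately show ?case by (intro exI[of _ "{}"] exI[of _ "\<lambda>_. undefined"]) (auto simp: edges_of_def)
next
  case (pendant W T v B)
  then obtain P p where P: "partition_on (W - {r}) P" and p: "p \<in> parent_functions {r} P"
    and T: "T = edges_of p P" by blast
  have r: "r \<in> W" using grown_hypertree[OF pendant.hyps(1)] by simp
  have un: "\<Union>P = W - {r}" using P by (simp add: partition_on_def)
  have B: "B \<notin> P" "disjnt B (\<Union>P)" using un pendant.hyps by (auto simp: disjnt_def)
  let ?p = "p(B := v)"
  have "W \<union> B - {r} - B = W - {r}" using pendant.hyps by auto
  then have "partition_on (W \<union> B - {r}) (insert B P)"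
    using partition_on_insert[OF B(2), of "W \<union> B - {r}"] P pendant.hyps r by auto
  moreover have "?p \<in> parent_functions {r} (insert B P)"
    unfolding parent_functions_def
  proof (intro CollectI conjI allI impI)
    show "?p \<in> extensional (insert B P)" using p by (auto simp: parent_functions_def extensional_def)
    fix X assume X: "X \<subseteq> insert B P" "X \<noteq> {}"
    show "\<exists>C\<in>X. ?p C \<in> {r} \<union> \<Union>(insert B P - X)"
    proof (cases "X \<subseteq> {B}")
      case True
      then have "X = {B}" using X by auto
      moreover have "insert B P - {B} = P" using B by auto
      ultimately show ?thesis using un pendant.hyps(2) by auto
    next
      case False
      then have "X - {B} \<noteq> {}" "X - {B} \<subseteq> P" using X by auto
      then obtain C where "C \<in> X - {B}" "p C \<in> {r} \<union> \<Union>(P - (X - {B}))"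
        using parent_functionsD[OF p] by metis
      then show ?thesis using B(1) by (intro bexI[of _ C]) auto
    qed
  qed
  moreover have "insert (insert v B) T = edges_of ?p (insert B P)"
  proof -
    have "edges_of ?p P = edges_of p P"
      using B(1) unfolding edges_of_def by (intro image_cong) auto
    then show ?thesis by (simp add: T edges_of_def)
  qed
  ultimately show ?case by (intro exI conjI)
qed

lemma parent_notin_block:
  assumes "disjoint P" "r \<notin> \<Union>P" "p \<in> parent_functions {r} P" "B \<in> P"
  shows "p B \<notin> B"
proof
  assume B: "p B \<in> B"
  then have "p B \<noteq> r" using assms(2,4) by blast
  then obtain C where C: "C \<in> P" "C \<noteq> B" "p B \<in> C"
    using parent_functions_range[OF assms(3,4)] by blast
  then show False using disjointD[OF assms(1,4) C(1)] B by blast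
qed

lemma parent_function_no_two_cycle:
  assumes "disjoint P" "r \<notin> \<Union>P" "p \<in> parent_functions {r} P" "B \<in> P" "C \<in> P"
  shows "\<not> (p B \<in> C \<and> p C \<in> B)"
proof
  assume *: "p B \<in> C \<and> p C \<in> B"
  obtain D where D: "D \<in> {B, C}" "p D \<in> {r} \<union> \<Union>(P - {B, C})"
    by (rule parent_functionsD[OF assms(3), of "{B, C}"]) (use assms(4,5) in simp_all)
  then obtain E where E: "E \<in> {B, C}" "p D \<in> E" using * by blast
  then have "E \<in> P" using assms(4,5) by blast
  then have "p D \<noteq> r" using E assms(2) by blast
  then obtain F where F: "F \<in> P" "F \<noteq> E" "p D \<in> F" using D(2) E(1) by blast
  then show False using disjointD[OF assms(1) \<open>E \<in> P\<close> F(1)] E(2) by blast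
qed

lemma inj_on_edge:
  assumes P: "partition_on (V - {r}) P" and p: "p \<in> parent_functions {r} P"
  shows "inj_on (\<lambda>B. insert (p B) B) P"
proof (rule inj_onI, rule ccontr)
  fix B C assume BC: "B \<in> P" "C \<in> P" "insert (p B) B = insert (p C) C" "B \<noteq> C"
  have dis: "disjoint P" "{} \<notin> P" "r \<notin> \<Union>P" using P by (auto simp: partition_on_def)
  have "B \<inter> C = {}" using disjointD[OF dis(1) BC(1,2,4)] .
  moreover have "B \<noteq> {}" "C \<noteq> {}" using BC(1,2) dis(2) by blast+
  ultimately have "p C \<in> B \<and> p B \<in> C" using BC(3) by (metis Int_iff all_not_in_conv insertCI insertE)
  then show False using parent_function_no_two_cycle[OF dis(1,3) p BC(1,2)] by simp
qed

text \<open>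
  Two descriptions of the same hyperedges are compared outwards from the root. Among the blocks on
  which they differ, choose \<open>B\<close> whose parent \<open>p B\<close> is the root or lies in a block \<open>C\<close> on which they
  agree. The second description cannot have \<open>p B\<close> inside its block \<open>B'\<close> of the same hyperedge:
  otherwise \<open>B' = C\<close>, and \<open>B\<close> and \<open>C\<close> would give the same hyperedge. So both have the same parent
  there, and thus the same block.
\<close>
lemma blocks_determined_by_edges:
  assumes P: "partition_on (V - {r}) P" "p \<in> parent_functions {r} P"
    and P': "partition_on (V - {r}) P'" "p' \<in> parent_functions {r} P'"
    and eq: "edges_of p P = edges_of p' P'"
  shows "\<forall>B\<in>P. B \<in> P' \<and> p B = p' B"
proof (rule ccontr)
  have dis: "disjoint P" "{} \<notin> P" "r \<notin> \<Union>P" and dis': "disjoint P'" "{} \<notin> P'" "r \<notin> \<Union>P'"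
    using P P' by (auto simp: partition_on_def)
  define X where "X = {B \<in> P. \<not> (B \<in> P' \<and> p B = p' B)}"
  assume "\<not> ?thesis"
  then have "X \<noteq> {}" "X \<subseteq> P" by (auto simp: X_def)
  then obtain B where B: "B \<in> X" "p B \<in> {r} \<union> \<Union>(P - X)"
    using parent_functionsD[OF P(2)] by metis
  have "B \<in> P" using B(1) by (simp add: X_def)
  then have "insert (p B) B \<in> edges_of p' P'" using eq by (auto simp: edges_of_def)
  then obtain B' where B': "B' \<in> P'" "insert (p B) B = insert (p' B') B'"
    by (auto simp: edges_of_def)
  have same: "p B = p' B'"
  proof (rule ccontr)
    assume "p B \<noteq> p' B'"
    then have v: "p B \<in> B'" using B'(2) by blast
    then have "p B \<noteq> r" using dis'(3) B'(1) by blast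
    then obtain C where C: "C \<in> P - X" "p B \<in> C" using B(2) by blast
    then have C': "C \<in> P" "C \<in> P'" "p C = p' C" by (simp_all add: X_def)
    have "C = B'" using disjointD[OF dis'(1) C'(2) B'(1)] v C(2) by blast
    then have "insert (p B) B = insert (p C) C" using B'(2) C' by simp
    then have "B = C" by (rule inj_onD[OF inj_on_edge[OF P] _ \<open>B \<in> P\<close> C'(1)])
    then show False using B(1) C(1) by simp
  qed
  have "p B \<notin> B" "p B \<notin> B'"
    using parent_notin_block[OF dis(1,3) P(2) \<open>B \<in> P\<close>]
      parent_notin_block[OF dis'(1,3) P'(2) B'(1)] same by simp_all
  then have "B = B'" using B'(2) unfolding same[symmetric] by (metis Diff_insert_absorb)
  then show False using same B' B(1) by (simp add: X_def)
qed

lemma bij_betw_edges_of: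
  assumes "finite V" "r \<in> V"
  shows "bij_betw (\<lambda>(P, p). edges_of p P)
    (SIGMA P:{P. partition_on (V - {r}) P}. parent_functions {r} P) {T. hypertree V T}"
  unfolding bij_betw_def
proof (intro conjI set_eqI iffI inj_onI)
  fix t t'
  assume t: "t \<in> (SIGMA P:{P. partition_on (V - {r}) P}. parent_functions {r} P)"
    and t': "t' \<in> (SIGMA P:{P. partition_on (V - {r}) P}. parent_functions {r} P)"
    and eq: "(case t of (P, p) \<Rightarrow> edges_of p P) = (case t' of (P, p) \<Rightarrow> edges_of p P)"
  obtain P p P' p' where tt: "t = (P, p)" "t' = (P', p')" by (cases t; cases t')
  have P: "partition_on (V - {r}) P" "p \<in> parent_functions {r} P"
    and P': "partition_on (V - {r}) P'" "p' \<in> parent_functions {r} P'"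
    and eq': "edges_of p P = edges_of p' P'"
    using t t' eq tt by auto
  have "P = P'" and "\<forall>B\<in>P. p B = p' B"
    using blocks_determined_by_edges[OF P P' eq'] blocks_determined_by_edges[OF P' P eq'[symmetric]]
    by blast+
  moreover have "p \<in> extensional P" "p' \<in> extensional P'"
    using P P' by (auto simp: parent_functions_def)
  ultimately show "t = t'" unfolding tt by (auto intro: extensionalityI)
next
  fix T
  assume "T \<in> (\<lambda>(P, p). edges_of p P) `
    (SIGMA P:{P. partition_on (V - {r}) P}. parent_functions {r} P)"
  then show "T \<in> {T. hypertree V T}"
    using grown_from_parent_function[OF assms] grown_hypertree by fastforce
next
  fix T assume "T \<in> {T. hypertree V T}"
  then show "T \<in> (\<lambda>(P, p). edges_of p P) `
    (SIGMA P:{P. partition_on (V - {r}) P}. parent_functions {r} P)"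
    using parent_function_from_grown[OF hypertree_grown[OF _ assms(2)]] by (force simp: image_iff)
qed

section \<open>The degree enumerator of hypertrees\<close>

lemma prod_power_hdegree:
  fixes x :: "'a \<Rightarrow> 'r :: comm_monoid_mult"
  assumes "finite V" "finite T" "\<Union>T \<subseteq> V"
  shows "(\<Prod>j\<in>V. x j ^ hdegree T j) = (\<Prod>e\<in>T. \<Prod>j\<in>e. x j)"
proof -
  have "(\<Prod>e\<in>T. \<Prod>j\<in>e. x j) = (\<Prod>e\<in>T. \<Prod>j\<in>{j \<in> V. j \<in> e}. x j)"
    using assms(3) by (intro prod.cong) auto
  also have "\<dots> = (\<Prod>j\<in>V. \<Prod>e\<in>{e \<in> T. j \<in> e}. x j)"
    by (rule prod.swap_restrict[OF assms(2,1)])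
  finally show ?thesis by (simp add: hdegree_def)
qed

text \<open>
  The product of the variables over all incidences of vertex and hyperedge can be grouped by vertices,
  giving \<open>x j ^ hdegree T j\<close>, or by hyperedges, giving \<open>x (p B)\<close> times the product over the block \<open>B\<close>.
  The blocks cover every vertex but \<open>r\<close> once, which accounts for the factor \<open>x r\<close>. The variables are
  nonzero so that the others can be cancelled.
\<close>
lemma prod_degree_edges_of:
  fixes x :: "'a \<Rightarrow> 'r :: idom"
  assumes V: "finite V" "r \<in> V" "V \<noteq> {r}" and P: "partition_on (V - {r}) P"
    and p: "p \<in> parent_functions {r} P" and x: "\<And>j. j \<in> V \<Longrightarrow> x j \<noteq> 0"
  shows "x r * (\<Prod>j\<in>V. x j ^ (hdegree (edges_of p P) j - 1)) = (\<Prod>B\<in>P. x (p B))"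
proof -
  let ?T = "edges_of p P"
  have dis: "disjoint P" "{} \<notin> P" and un: "\<Union>P = V - {r}"
    using P by (auto simp: partition_on_def)
  have r: "r \<notin> \<Union>P" using un by simp
  have "finite P" using P V finite_elements by blast
  have finB: "finite B" if "B \<in> P" for B
    using that un V(1) by (auto intro!: finite_subset[of B V])
  have "hypertree V ?T"
    using grown_hypertree[OF grown_from_parent_function[OF V(1,2) P p]] by simp
  then have sub: "\<Union>?T \<subseteq> V" by (auto simp: hypertree_def hyperforest_def hypergraph_def)
  have "finite ?T" using \<open>finite P\<close> by (simp add: edges_of_def)
  have deg: "hdegree ?T j \<noteq> 0" if "j \<in> V" for j
  proof -
    have "\<exists>e\<in>?T. j \<in> e"
    proof (cases "j = r")
      case True
      \<comment> \<open>For the set of all blocks, acyclicity yields a block that hangs from the root itself.\<close>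
      have "P \<noteq> {}" using un V by auto
      then obtain B where "B \<in> P" "p B \<in> {r} \<union> \<Union>(P - P)"
        using parent_functionsD[OF p, of P] by blast
      then show ?thesis using True by (auto simp: edges_of_def)
    next
      case False
      then have "j \<in> \<Union>P" using un that by simp
      then obtain B where "B \<in> P" "j \<in> B" by (rule UnionE)
      then show ?thesis by (auto simp: edges_of_def)
    qed
    then have "{e \<in> ?T. j \<in> e} \<noteq> {}" by blast
    then show ?thesis using \<open>finite ?T\<close> by (simp add: hdegree_def)
  qed
  have rest: "(\<Prod>j\<in>V - {r}. x j) = (\<Prod>B\<in>P. \<Prod>j\<in>B. x j)"
    unfolding un[symmetric] using finB disjointD[OF dis(1)]
    by (simp add: prod.Union_disjoint)
  have "(x r * (\<Prod>j\<in>V. x j ^ (hdegree ?T j - 1))) * (\<Prod>j\<in>V - {r}. x j) =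
      (\<Prod>j\<in>V. x j ^ (hdegree ?T j - 1)) * (\<Prod>j\<in>V. x j)"
    using V by (simp add: prod.remove[of V r] ac_simps)
  also have "\<dots> = (\<Prod>j\<in>V. x j ^ hdegree ?T j)"
    unfolding prod.distrib[symmetric]
    by (rule prod.cong[OF refl], rule power_minus_mult) (use deg in blast)
  also have "\<dots> = (\<Prod>e\<in>?T. \<Prod>j\<in>e. x j)"
    by (rule prod_power_hdegree[OF V(1) \<open>finite ?T\<close> sub])
  also have "\<dots> = (\<Prod>B\<in>P. \<Prod>j\<in>insert (p B) B. x j)"
    unfolding edges_of_def by (simp add: prod.reindex[OF inj_on_edge[OF P p]])
  also have "\<dots> = (\<Prod>B\<in>P. x (p B) * (\<Prod>j\<in>B. x j))"
    using parent_notin_block[OF dis(1) r p] finB by (intro prod.cong) auto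
  also have "\<dots> = (\<Prod>B\<in>P. x (p B)) * (\<Prod>j\<in>V - {r}. x j)"
    by (simp add: prod.distrib rest)
  finally show ?thesis
    using x V(1) by (simp add: mult_cancel_right)
qed

lemma type_of_edges_of:
  assumes V: "finite V" and P: "partition_on (V - {r}) P" and p: "p \<in> parent_functions {r} P"
  shows "image_mset card (mset_set (edges_of p P)) = image_mset Suc (image_mset card (mset_set P))"
proof -
  have dis: "disjoint P" "r \<notin> \<Union>P" and un: "\<Union>P = V - {r}" using P by (auto simp: partition_on_def)
  have finP: "finite P" using P V finite_elements by blast
  have "card (insert (p B) B) = Suc (card B)" if "B \<in> P" for B
  proof -
    have "B \<subseteq> V" using that un by blast
    then have "finite B" using V finite_subset by blast
    then show ?thesis using parent_notin_block[OF dis p that] by simp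
  qed
  then have "image_mset (\<lambda>B. card (insert (p B) B)) (mset_set P) = image_mset (\<lambda>B. Suc (card B)) (mset_set P)"
    using finP by (intro image_mset_cong) simp
  then show ?thesis
    unfolding edges_of_def
    by (simp add: image_mset_mset_set[OF inj_on_edge[OF P p], symmetric] multiset.map_comp o_def)
qed

definition hypertrees_of_type :: "'a set \<Rightarrow> nat multiset \<Rightarrow> 'a set set set" where
  "hypertrees_of_type V M = {T. hypertree V T \<and> image_mset card (mset_set T) = image_mset Suc M}"

lemma bij_betw_edges_of_type:
  assumes "finite V" "r \<in> V"
  shows "bij_betw (\<lambda>(P, p). edges_of p P)
    (SIGMA P:partitions_of_type (V - {r}) M. parent_functions {r} P) (hypertrees_of_type V M)"
proof -
  have restrict_codomain: "bij_betw f {t \<in> S. f t \<in> C} {T \<in> H. T \<in> C}"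
    if "bij_betw f S H" for f :: "'c \<Rightarrow> 'd" and S H C
    using that unfolding bij_betw_def by (auto intro: inj_on_subset)
  let ?S = "SIGMA P:{P. partition_on (V - {r}) P}. parent_functions {r} P"
  let ?f = "\<lambda>(P, p). edges_of p P"
  have Suc_inj: "M' = M" if "image_mset Suc M' = image_mset Suc M" for M'
    using arg_cong[OF that, of "image_mset (\<lambda>m. m - 1)"] by (simp add: multiset.map_comp o_def)
  have "image_mset card (mset_set (edges_of p P)) = image_mset Suc M \<longleftrightarrow>
      image_mset card (mset_set P) = M"
    if "partition_on (V - {r}) P" "p \<in> parent_functions {r} P" for P p
    unfolding type_of_edges_of[OF assms(1) that]
    using Suc_inj by blast
  then have "(SIGMA P:partitions_of_type (V - {r}) M. parent_functions {r} P) =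
      {t \<in> ?S. ?f t \<in> {T. image_mset card (mset_set T) = image_mset Suc M}}"
    by (auto simp: partitions_of_type_def)
  moreover have "hypertrees_of_type V M =
      {T \<in> {T. hypertree V T}. T \<in> {T. image_mset card (mset_set T) = image_mset Suc M}}"
    by (auto simp: hypertrees_of_type_def)
  ultimately show ?thesis
    using restrict_codomain[OF bij_betw_edges_of[OF assms]] by (simp only:)
qed

text \<open>
  The sum over parent functions is the same for every set partition, so the number of set partitions
  comes out as a factor.
\<close>
lemma sum_hypertrees_of_type:
  fixes x :: "'a \<Rightarrow> 'r :: idom"
  assumes V: "finite V" "r \<in> V" "V \<noteq> {r}" and x: "\<And>j. j \<in> V \<Longrightarrow> x j \<noteq> 0"
  shows "(\<Sum>T\<in>hypertrees_of_type V M. \<Prod>j\<in>V. x j ^ (hdegree T j - 1)) =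
    of_nat (card (partitions_of_type (V - {r}) M)) * sum x V ^ (size M - 1)"
proof -
  let ?N = "partitions_of_type (V - {r}) M"
  have P: "partition_on (V - {r}) P" "finite P" "\<Union>P = V - {r}" "disjoint P" "P \<noteq> {}" "card P = size M"
    "\<And>B. B \<in> P \<Longrightarrow> finite B"
    if "P \<in> ?N" for P
  proof -
    show part: "partition_on (V - {r}) P" using that by (simp add: partitions_of_type_def)
    then show "\<Union>P = V - {r}" "disjoint P" by (auto simp: partition_on_def)
    then show "P \<noteq> {}" "\<And>B. B \<in> P \<Longrightarrow> finite B"
      using V by (auto intro: finite_subset[of _ V])
    show "finite P" using part V(1) finite_elements by blast
    have "size (image_mset card (mset_set P)) = size M"
      using that by (simp add: partitions_of_type_def)
    then show "card P = size M" by simp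
  qed
  have fin: "finite (parent_functions {r} P)" if "P \<in> ?N" for P
    using P[OF that] by (intro finite_parent_functions) auto
  have "x r * (\<Sum>T\<in>hypertrees_of_type V M. \<Prod>j\<in>V. x j ^ (hdegree T j - 1)) =
      (\<Sum>(P, p)\<in>(SIGMA P:?N. parent_functions {r} P). x r * (\<Prod>j\<in>V. x j ^ (hdegree (edges_of p P) j - 1)))"
    using sum.reindex_bij_betw[OF bij_betw_edges_of_type[OF V(1,2), of M],
        of "\<lambda>T. x r * (\<Prod>j\<in>V. x j ^ (hdegree T j - 1))"]
    by (simp add: sum_distrib_left case_prod_unfold)
  also have "\<dots> = (\<Sum>P\<in>?N. \<Sum>p\<in>parent_functions {r} P.
      x r * (\<Prod>j\<in>V. x j ^ (hdegree (edges_of p P) j - 1)))"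
    using fin V(1) by (subst sum.Sigma) (auto intro: finite_partitions_of_type)
  also have "\<dots> = (\<Sum>P\<in>?N. \<Sum>p\<in>parent_functions {r} P. \<Prod>B\<in>P. x (p B))"
    using prod_degree_edges_of[OF V P(1) _ x] by (intro sum.cong) auto
  also have "\<dots> = (\<Sum>P\<in>?N. x r * sum x V ^ (size M - 1))"
  proof (rule sum.cong[OF refl])
    fix Q assume Q: "Q \<in> ?N"
    have "(\<Sum>p\<in>parent_functions {r} Q. \<Prod>B\<in>Q. x (p B)) =
        sum x {r} * (sum x {r} + sum x (\<Union>Q)) ^ (card Q - 1)"
      using P[OF Q] by (intro sum_parent_functions) auto
    also have "sum x {r} + sum x (\<Union>Q) = sum x V"
      using P(3)[OF Q] V by (simp add: sum.remove[of V r])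
    finally show "(\<Sum>p\<in>parent_functions {r} Q. \<Prod>B\<in>Q. x (p B)) = x r * sum x V ^ (size M - 1)"
      using P(6)[OF Q] by simp
  qed
  also have "\<dots> = x r * (of_nat (card ?N) * sum x V ^ (size M - 1))" by simp
  finally show ?thesis using x[OF V(2)] by simp
qed

lemma const_poly_of_nat: "const_poly (of_nat m) = of_nat m"
  by (induction m) (simp_all add: const_poly_def single_add)

lemma indet_nonzero: "indet j \<noteq> 0"
proof
  assume "indet j = 0"
  then have "Poly_Mapping.lookup (indet j) (Poly_Mapping.single j 1) = 0" by simp
  then show False by (simp add: indet_def)
qed

lemma mult_of_part_count: "mult_of_part lam j = count (mset lam) j"
  by (simp add: mult_of_part_def count_mset count_list_eq_length_filter length_filter_conv_card eq_commute)

lemma prod_list_map_nth: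
  fixes f :: "'a \<Rightarrow> 'b :: comm_monoid_mult"
  shows "(\<Prod>l\<leftarrow>xs. f l) = (\<Prod>i<length xs. f (xs ! i))"
  by (induction xs) (simp_all add: prod.lessThan_Suc_shift del: prod.lessThan_Suc)

theorem theorem1p2:
  fixes n k :: nat and lam :: "nat list"
  assumes "1 \<le> n" and "1 \<le> k" and "k \<le> n"
    and "partition_into n k lam"
  shows "(\<Sum>T\<in>HT lam n. \<Prod>j=0..n. indet j ^ (hdegree T j - 1)) =
    const_poly (multinomial n lam * (1 / (\<Prod>j=1..n. fact (mult_of_part lam j)))) *
      (\<Sum>j=0..n. indet j) ^ (k - 1)"
proof -
  let ?N = "partitions_of_type ({0..n} - {0}) (mset lam)"
  have lam: "length lam = k" "sum_list lam = n" "\<forall>l\<in>set lam. 1 \<le> l"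
    using assms(4) by (auto simp: partition_into_def)
  have HT: "HT lam n = hypertrees_of_type {0..n} (mset lam)"
    by (simp add: HT_def hypertrees_of_type_def)
  have "l \<le> n" if "l \<in> set lam" for l
    using member_le_sum_list[OF that] lam(2) by simp
  then have "card ?N * (\<Prod>l\<in>#mset lam. fact l) * (\<Prod>j=1..n. fact (count (mset lam) j)) =
      fact (card ({0..n} - {0}))"
    using lam by (intro card_partitions_of_type) (auto simp: sum_mset_sum_list)
  then have "of_nat (card ?N * (\<Prod>l\<in>#mset lam. fact l) * (\<Prod>j=1..n. fact (mult_of_part lam j))) =
      (fact n :: rat)"
    by (simp add: mult_of_part_count)
  moreover have "of_nat (\<Prod>l\<in>#mset lam. fact l) = (\<Prod>i<length lam. fact (lam ! i) :: rat)"
    by (simp add: prod_mset_prod_list prod_list_map_nth flip: mset_map)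
  ultimately have "of_nat (card ?N) * (\<Prod>i<length lam. fact (lam ! i)) *
      (\<Prod>j=1..n. fact (mult_of_part lam j)) = (fact n :: rat)"
    by simp
  then have "(of_nat (card ?N) :: rat) =
      multinomial n lam * (1 / (\<Prod>j=1..n. fact (mult_of_part lam j)))"
    by (simp add: multinomial_def field_simps)
  then have "of_nat (card ?N) =
      const_poly (multinomial n lam * (1 / (\<Prod>j=1..n. fact (mult_of_part lam j))))"
    by (metis const_poly_of_nat)
  moreover have "(\<Sum>T\<in>HT lam n. \<Prod>j=0..n. indet j ^ (hdegree T j - 1)) =
      of_nat (card ?N) * (\<Sum>j=0..n. indet j) ^ (size (mset lam) - 1)"
    unfolding HT using assms(1) by (intro sum_hypertrees_of_type) (auto simp: indet_nonzero)
  ultimately show ?thesis using lam(1) by simp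
qed

end
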